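(* Let $G$ be an outer-planar group satisfying the ascending and descending chain conditions on subgroups. Then $G$ is finite, and hence $G$ is isomorphic to $\mathbb{Z}_{p^m}$ or $\mathbb{Z}_{p^mq}$ for some distinct primes $p,q$ and some non-negative integer $m$.
   Context: For a group $G$, the subgroup graph $\mathcal{L}(G)$ is the graph whose vertices are all subgroups of $G$, two subgroups $H,K$ being adjacent if one of them is a maximal subgroup of the other. A graph is outer-planar if it has a planar embedding in which every vertex lies on the boundary of the unbounded face. $G$ is an outer-planar group if $\mathcal{L}(G)$ is outer-planar. $\mathbb{Z}_n$ denotes the cyclic group of order $n$. *)

theory Defs
  imports "HOL-Analysis.Analysis" "HOL-Algebra.Elementary_Groups"
begin

text \<open>A graph is given by a vertex set V and an adjacency relation E (assumed
symmetric and irreflexive on V where relevant). A planar drawing in the plane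
(identified with the complex numbers) places vertices at distinct points p v and
draws every edge {u,v} as an arc from p u to p v; the arcs for distinct edges meet
only in common end vertices, and no arc passes through a vertex other than its
end points. The graph is outer-planar if it has such a drawing in which every
vertex lies on the boundary of an unbounded face, i.e. of an unbounded
connected component of the complement of the drawing.\<close>

definition graph_drawing ::
  "'v set \<Rightarrow> ('v \<Rightarrow> 'v \<Rightarrow> bool) \<Rightarrow> ('v \<Rightarrow> complex) \<Rightarrow> ('v \<Rightarrow> 'v \<Rightarrow> real \<Rightarrow> complex) \<Rightarrow> complex set"
  where
  "graph_drawing V E p \<gamma> =
     p ` V \<union> \<Union>{path_image (\<gamma> u v) | u v. u \<in> V \<and> v \<in> V \<and> E u v}"

definition planar_embedding ::
  "'v set \<Rightarrow> ('v \<Rightarrow> 'v \<Rightarrow> bool) \<Rightarrow> ('v \<Rightarrow> complex) \<Rightarrow> ('v \<Rightarrow> 'v \<Rightarrow> real \<Rightarrow> complex) \<Rightarrow> bool"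
  where
  "planar_embedding V E p \<gamma> \<longleftrightarrow>
     inj_on p V \<and>
     (\<forall>u\<in>V. \<forall>v\<in>V. E u v \<longrightarrow>
        arc (\<gamma> u v) \<and> pathstart (\<gamma> u v) = p u \<and> pathfinish (\<gamma> u v) = p v \<and>
        path_image (\<gamma> v u) = path_image (\<gamma> u v)) \<and>
     (\<forall>u\<in>V. \<forall>v\<in>V. \<forall>w\<in>V. E u v \<longrightarrow> p w \<in> path_image (\<gamma> u v) \<longrightarrow> w = u \<or> w = v) \<and>
     (\<forall>u\<in>V. \<forall>v\<in>V. \<forall>u'\<in>V. \<forall>v'\<in>V. E u v \<longrightarrow> E u' v' \<longrightarrow> {u, v} \<noteq> {u', v'} \<longrightarrow>
        path_image (\<gamma> u v) \<inter> path_image (\<gamma> u' v') \<subseteq> p ` ({u, v} \<inter> {u', v'}))"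

definition outer_planar_graph :: "'v set \<Rightarrow> ('v \<Rightarrow> 'v \<Rightarrow> bool) \<Rightarrow> bool"
  where
  "outer_planar_graph V E \<longleftrightarrow>
     (\<exists>p \<gamma>. planar_embedding V E p \<gamma> \<and>
        (\<exists>F \<in> components (UNIV - graph_drawing V E p \<gamma>).
            \<not> bounded F \<and> p ` V \<subseteq> frontier F))"

definition maximal_subgroup :: "'a set \<Rightarrow> 'a set \<Rightarrow> ('a, 'b) monoid_scheme \<Rightarrow> bool"
  where
  "maximal_subgroup H K G \<longleftrightarrow>
     subgroup H G \<and> subgroup K G \<and> H \<subset> K \<and>
     (\<forall>L. subgroup L G \<longrightarrow> H \<subseteq> L \<longrightarrow> L \<subseteq> K \<longrightarrow> L = H \<or> L = K)"

definition subgroup_graph_adj :: "('a, 'b) monoid_scheme \<Rightarrow> 'a set \<Rightarrow> 'a set \<Rightarrow> bool"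
  where
  "subgroup_graph_adj G H K \<longleftrightarrow> maximal_subgroup H K G \<or> maximal_subgroup K H G"

definition outer_planar_group :: "('a, 'b) monoid_scheme \<Rightarrow> bool"
  where
  "outer_planar_group G \<longleftrightarrow>
     outer_planar_graph {H. subgroup H G} (subgroup_graph_adj G)"

definition subgroup_acc :: "('a, 'b) monoid_scheme \<Rightarrow> bool"
  where
  "subgroup_acc G \<longleftrightarrow>
     (\<forall>f :: nat \<Rightarrow> 'a set. (\<forall>n. subgroup (f n) G) \<longrightarrow> (\<forall>n. f n \<subseteq> f (Suc n)) \<longrightarrow>
        (\<exists>N. \<forall>n\<ge>N. f n = f N))"

definition subgroup_dcc :: "('a, 'b) monoid_scheme \<Rightarrow> bool"
  where
  "subgroup_dcc G \<longleftrightarrow>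
     (\<forall>f :: nat \<Rightarrow> 'a set. (\<forall>n. subgroup (f n) G) \<longrightarrow> (\<forall>n. f (Suc n) \<subseteq> f n) \<longrightarrow>
        (\<exists>N. \<forall>n\<ge>N. f n = f N))"

end

theory Submission
  imports Defs "HOL-Algebra.Multiplicative_Group"
begin

text \<open>An outer-planar graph contains no theta, that is, no three internally disjoint paths of length
  at least two with common ends. If a subgroup had three maximal subgroups, suitable
  chains of maximal inclusions below them would form a theta, so \<open>G\<close> has at most two maximal
  subgroups. Since a group is not the union of two proper subgroups, some element lies in no maximal
  subgroup, and by the ascending chain condition it generates \<open>G\<close>. The descending chain condition
  makes this cyclic group finite. Three primes dividing its order would give three maximal
  subgroups, and a divisor \<open>p\<^sup>2 q\<^sup>2\<close> would give a theta in the three by three grid of subgroups.\<close>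

subsection \<open>Theta graphs\<close>

lemma Jordan_two_arcs:
  fixes g h :: "real \<Rightarrow> complex"
  assumes "arc g" "arc h" "pathstart g = a" "pathfinish g = b" "pathstart h = a" "pathfinish h = b"
    and "path_image g \<inter> path_image h = {a, b}"
  defines "J \<equiv> path_image g \<union> path_image h"
  shows "inside J \<noteq> {} \<and> open (inside J) \<and> connected (inside J) \<and> open (outside J) \<and>
    connected (outside J) \<and> bounded (inside J) \<and> inside J \<inter> outside J = {} \<and>
    inside J \<union> outside J = - J \<and> frontier (inside J) = J \<and> frontier (outside J) = J"
proof -
  have "simple_path (g +++ reversepath h)"
    using assms by (intro simple_path_join_loop) (auto simp: arc_reversepath)
  moreover have "path_image (g +++ reversepath h) = J"
    using assms by (simp add: path_image_join)
  moreover have "pathfinish (g +++ reversepath h) = pathstart (g +++ reversepath h)"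
    using assms by simp
  ultimately show ?thesis
    using Jordan_inside_outside[of "g +++ reversepath h"] by simp
qed

lemma connected_disjoint_imp_subset_inside_or_outside:
  fixes J :: "'a::euclidean_space set"
  assumes "closed J" "connected S" "S \<inter> J = {}"
  shows "S \<subseteq> inside J \<or> S \<subseteq> outside J"
proof -
  have "S \<subseteq> inside J \<union> outside J"
    using assms(3) by (auto simp: inside_Un_outside)
  moreover have "inside J \<inter> outside J \<inter> S = {}"
    using inside_Int_outside[of J] by blast
  ultimately show ?thesis
    using connectedD[OF assms(2) open_inside[OF assms(1)] open_outside[OF assms(1)]] by blast
qed

text \<open>\<open>F\<close> is connected, unbounded and off the Jordan curve formed by
  \<open>g\<close> and \<open>h\<close>, so it cannot lie in the bounded inside. The point
  \<open>z\<close> is in the closure of \<open>F\<close> and off the curve, hence outside too. The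
  arc \<open>k\<close> without its ends is connected and misses the curve, so all of it is on the
  same side as \<open>z\<close>.\<close>

lemma theta_arc_avoids_inside:
  fixes g h k :: "real \<Rightarrow> complex"
  assumes "arc g" "arc h" "arc k"
    and "pathstart g = a" "pathfinish g = b" "pathstart h = a" "pathfinish h = b"
    and "pathstart k = a" "pathfinish k = b"
    and "path_image g \<inter> path_image h = {a, b}"
    and "path_image g \<inter> path_image k = {a, b}" "path_image h \<inter> path_image k = {a, b}"
    and F: "connected F" "\<not> bounded F" "F \<inter> (path_image g \<union> path_image h) = {}"
    and z: "z \<in> path_image k - {a, b}" "z \<in> closure F"
  shows "F \<subseteq> outside (path_image g \<union> path_image h)"
    and "inside (path_image g \<union> path_image h) \<inter> path_image k = {}"
proof -
  let ?J = "path_image g \<union> path_image h"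
  have J: "bounded (inside ?J)" "frontier (outside ?J) = ?J" "inside ?J \<inter> ?J = {}"
     "inside ?J \<inter> outside ?J = {}"
    using Jordan_two_arcs[of g h a b] assms by auto
  have cl: "closed ?J"
    using assms by (simp add: closed_Un closed_arc_image)
  show Fo: "F \<subseteq> outside ?J"
    using connected_disjoint_imp_subset_inside_or_outside[OF cl F(1,3)] J(1) F(2) bounded_subset
    by blast
  have "closure F \<subseteq> outside ?J \<union> ?J"
    using closure_mono[OF Fo] J(2) by (metis closure_Un_frontier)
  moreover have "z \<notin> ?J"
    using z assms by blast
  ultimately have "z \<in> outside ?J"
    using z by blast
  moreover have "connected (path_image k - {a, b})"
    using connected_simple_path_endless[of k] assms by (auto simp: arc_imp_simple_path)
  moreover have "(path_image k - {a, b}) \<inter> ?J = {}"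
    using assms by blast
  ultimately have "path_image k - {a, b} \<subseteq> outside ?J"
    using connected_disjoint_imp_subset_inside_or_outside[OF cl] z J(4) by blast
  moreover have "{a, b} \<subseteq> ?J"
    using assms by blast
  ultimately show "inside ?J \<inter> path_image k = {}"
    using J by blast
qed

text \<open>Each inside is connected and misses the other curve, so if the two insides met, each
  would contain the other. Equal insides have equal frontiers, so the curves would coincide, yet
  \<open>y\<close> lies on only one of them.\<close>

lemma theta_insides_disjoint:
  fixes g h k :: "real \<Rightarrow> complex"
  assumes "arc g" "arc h" "arc k"
    and "pathstart g = a" "pathfinish g = b" "pathstart h = a" "pathfinish h = b"
    and "pathstart k = a" "pathfinish k = b"
    and "path_image g \<inter> path_image h = {a, b}"
    and "path_image g \<inter> path_image k = {a, b}" "path_image h \<inter> path_image k = {a, b}"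
    and y: "y \<in> path_image h - {a, b}"
    and avoid: "inside (path_image g \<union> path_image h) \<inter> path_image k = {}"
      "inside (path_image g \<union> path_image k) \<inter> path_image h = {}"
  shows "inside (path_image g \<union> path_image h) \<inter> inside (path_image g \<union> path_image k) = {}"
proof (rule ccontr)
  let ?H = "path_image g \<union> path_image h" and ?K = "path_image g \<union> path_image k"
  assume ne: "inside ?H \<inter> inside ?K \<noteq> {}"
  have H: "connected (inside ?H)" "frontier (inside ?H) = ?H" "inside ?H \<inter> ?H = {}"
    "inside ?H \<inter> outside ?H = {}"
    using Jordan_two_arcs[of g h a b] assms by auto
  have K: "connected (inside ?K)" "frontier (inside ?K) = ?K" "inside ?K \<inter> ?K = {}"
    "inside ?K \<inter> outside ?K = {}"
    using Jordan_two_arcs[of g k a b] assms by auto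
  have cl: "closed ?H" "closed ?K"
    using assms by (simp_all add: closed_Un closed_arc_image)
  have "inside ?H \<inter> ?K = {}" "inside ?K \<inter> ?H = {}"
    using avoid H K by blast+
  then have "inside ?H \<subseteq> inside ?K" "inside ?K \<subseteq> inside ?H"
    using connected_disjoint_imp_subset_inside_or_outside[OF cl(2) H(1)]
      connected_disjoint_imp_subset_inside_or_outside[OF cl(1) K(1)] ne H(4) K(4) by blast+
  then have "inside ?H = inside ?K" by (rule subset_antisym)
  then have "?H = ?K"
    using H(2) K(2) by (metis (no_types))
  then have "y \<in> ?K"
    using y by blast
  then show False
    using y assms by blast
qed

text \<open>If all three arcs reach the frontier of \<open>F\<close>, the insides of the three Jordan curves are
  disjoint. A point inside \<open>g \<union> k\<close> is then joined to \<open>F\<close> both off \<open>g \<union> h\<close> and off \<open>h \<union> k\<close>, hence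
  off all three arcs by Janiszewski's theorem, as the two curves meet in the connected arc \<open>h\<close>.\<close>

lemma theta_not_outer:
  fixes g h k :: "real \<Rightarrow> complex"
  assumes "arc g" "arc h" "arc k"
    and "pathstart g = a" "pathfinish g = b" "pathstart h = a" "pathfinish h = b"
    and "pathstart k = a" "pathfinish k = b"
    and "path_image g \<inter> path_image h = {a, b}"
    and "path_image g \<inter> path_image k = {a, b}" "path_image h \<inter> path_image k = {a, b}"
    and F: "connected F" "\<not> bounded F" "F \<inter> (path_image g \<union> path_image h \<union> path_image k) = {}"
    and "x \<in> path_image g - {a, b}" "x \<in> closure F"
    and "y \<in> path_image h - {a, b}" "y \<in> closure F"
    and "z \<in> path_image k - {a, b}" "z \<in> closure F"
  shows False
proof -
  let ?gh = "path_image g \<union> path_image h" and ?gk = "path_image g \<union> path_image k"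
    and ?hk = "path_image h \<union> path_image k"
  note sym = Int_commute[of "path_image h" "path_image g"] Int_commute[of "path_image k" "path_image g"]
    Int_commute[of "path_image k" "path_image h"]
  have F': "F \<inter> ?gh = {}" "F \<inter> ?gk = {}" "F \<inter> ?hk = {}"
    using F(3) by blast+
  have gh: "F \<subseteq> outside ?gh" "inside ?gh \<inter> path_image k = {}"
    using theta_arc_avoids_inside[of g h k a b F z] assms sym F' by simp_all
  have gk: "F \<subseteq> outside ?gk" "inside ?gk \<inter> path_image h = {}"
    using theta_arc_avoids_inside[of g k h a b F y] assms sym F' by simp_all
  have hk: "F \<subseteq> outside ?hk" "inside ?hk \<inter> path_image g = {}"
    using theta_arc_avoids_inside[of h k g a b F x] assms sym F' by simp_all
  \<comment> \<open>The arc shared by the two curves is \<open>g\<close> in this fact and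
    \<open>k\<close> in the next.\<close>
  have d1: "inside ?gk \<inter> inside ?gh = {}"
    using theta_insides_disjoint[of g k h a b z] assms sym gh(2) gk(2) by auto
  have d2: "inside ?gk \<inter> inside ?hk = {}"
    using theta_insides_disjoint[of k g h a b x] assms sym gk(2) hk(2) by (auto simp: Un_commute)
  have Jgk: "inside ?gk \<noteq> {}" "inside ?gk \<inter> ?gk = {}" "inside ?gk \<inter> outside ?gk = {}"
    using Jordan_two_arcs[of g k a b] assms by auto
  have Jgh: "connected (outside ?gh)" "inside ?gh \<union> outside ?gh = - ?gh"
    using Jordan_two_arcs[of g h a b] assms by auto
  have Jhk: "connected (outside ?hk)" "inside ?hk \<union> outside ?hk = - ?hk"
    using Jordan_two_arcs[of h k a b] assms by auto
  obtain s where s: "s \<in> inside ?gk"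
    using Jgk by blast
  have "F \<noteq> {}" using F by auto
  then obtain t where t: "t \<in> F" by blast
  have "s \<in> outside ?gh" "s \<in> outside ?hk"
    using s d1 d2 Jgh Jhk Jgk(2) gk(2) by blast+
  moreover have "t \<in> outside ?gh" "t \<in> outside ?hk"
    using t gh hk by blast+
  moreover have "outside ?gh \<subseteq> - ?gh" "outside ?hk \<subseteq> - ?hk"
    using Jgh(2) Jhk(2) by blast+
  ultimately have cc: "connected_component (- ?gh) s t" "connected_component (- ?hk) s t"
    using Jgh(1) Jhk(1) unfolding connected_component_def by blast+
  have "?gh \<inter> ?hk = path_image h"
    using assms by blast
  then have con: "connected (?gh \<inter> ?hk)"
    using assms by (simp add: connected_arc_image)
  have "connected_component (- (?gh \<union> ?hk)) s t"
    by (rule Janiszewski[OF _ _ con cc])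
      (use assms in \<open>simp_all add: compact_Un closed_Un compact_arc_image closed_arc_image\<close>)
  then obtain T where T: "connected T" "T \<subseteq> - (?gh \<union> ?hk)" "s \<in> T" "t \<in> T"
    unfolding connected_component_def by blast
  \<comment> \<open>The connected set \<open>T\<close> misses the curve of \<open>g\<close> and
    \<open>k\<close>, but contains \<open>s\<close> inside it and \<open>t\<close> outside
    it.\<close>
  have "closed ?gk"
    using assms by (simp add: closed_Un closed_arc_image)
  then have "T \<subseteq> inside ?gk \<or> T \<subseteq> outside ?gk"
    using connected_disjoint_imp_subset_inside_or_outside[of ?gk T] T by blast
  then show False
    using T s t gk(1) Jgk(3) by blast
qed

section \<open>Paths in abstract graphs\<close>

text \<open>The vertex set is an argument because internal disjointness of paths is a condition on
  it. The requirement that the new vertex be fresh makes the path simple.\<close>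

inductive gpath :: "('v \<Rightarrow> 'v \<Rightarrow> bool) \<Rightarrow> 'v \<Rightarrow> 'v \<Rightarrow> 'v set \<Rightarrow> bool" for E where
  refl: "gpath E a a {a}"
| step: "E a b \<Longrightarrow> gpath E b c W \<Longrightarrow> a \<notin> W \<Longrightarrow> gpath E a c (insert a W)"

lemma gpath_ends: "gpath E a b W \<Longrightarrow> a \<in> W \<and> b \<in> W"
  by (induction rule: gpath.induct) auto

lemma gpath_refl_iff: "gpath E a a W \<longleftrightarrow> W = {a}"
proof
  assume "gpath E a a W"
  then show "W = {a}"
    by cases (auto dest: gpath_ends)
qed (simp add: gpath.refl)

lemma gpath_edge: "E a b \<Longrightarrow> a \<noteq> b \<Longrightarrow> gpath E a b {a, b}"
  using gpath.step[OF _ gpath.refl[of E b]] by simp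

lemma gpath_trans:
  "gpath E a b W \<Longrightarrow> gpath E b c X \<Longrightarrow> W \<inter> X \<subseteq> {b} \<Longrightarrow> gpath E a c (W \<union> X)"
proof (induction rule: gpath.induct)
  case (refl a)
  then show ?case
    using gpath_ends[of E a c X] by (simp add: insert_absorb)
next
  case (step a b d W)
  have "d \<in> W"
    using gpath_ends[OF step.hyps(2)] by simp
  then have "a \<notin> W \<union> X" "W \<inter> X \<subseteq> {d}"
    using step.hyps(3) step.prems(2) by blast+
  then show ?case
    using gpath.step[OF step.hyps(1) step.IH[OF step.prems(1)]] by simp
qed

lemma gpath_rev:
  assumes "symp E" shows "gpath E a b W \<Longrightarrow> gpath E b a W"
proof (induction rule: gpath.induct)
  case (refl a)
  show ?case by (rule gpath.refl)
next
  case (step a b c W)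
  have "b \<in> W" "b \<noteq> a" using step gpath_ends by fastforce+
  moreover have "gpath E b a {b, a}"
    using step assms \<open>b \<noteq> a\<close> by (intro gpath_edge) (auto dest: sympD)
  ultimately have "gpath E c a (W \<union> {b, a})"
    using step by (intro gpath_trans[OF step.IH]) auto
  then show ?case
    using \<open>b \<in> W\<close> by (simp add: insert_absorb)
qed

text \<open>Non-adjacent distinct ends force length at least two. The inner vertex later gives each
  arc of a theta a point on the frontier of the unbounded face.\<close>

lemma gpath_inner_vertex:
  assumes "gpath E a b W" "a \<noteq> b" "\<not> E a b"
  obtains c where "c \<in> W" "c \<noteq> a" "c \<noteq> b"
  using assms(1)
proof cases
  case refl
  then show ?thesis using assms by simp
next
  case (step c X)
  then show ?thesis using that[of c] assms gpath_ends[of E c b X] by auto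
qed

section \<open>From paths in the graph to arcs in the drawing\<close>

lemma planar_embedding_edges_Int:
  assumes "planar_embedding V E p \<gamma>" "u \<in> V" "v \<in> V" "u' \<in> V" "v' \<in> V"
    and "E u v" "E u' v'" "{u, v} \<noteq> {u', v'}"
  shows "path_image (\<gamma> u v) \<inter> path_image (\<gamma> u' v') \<subseteq> p ` ({u, v} \<inter> {u', v'})"
proof -
  have "\<forall>u\<in>V. \<forall>v\<in>V. \<forall>u'\<in>V. \<forall>v'\<in>V. E u v \<longrightarrow> E u' v' \<longrightarrow> {u, v} \<noteq> {u', v'} \<longrightarrow>
        path_image (\<gamma> u v) \<inter> path_image (\<gamma> u' v') \<subseteq> p ` ({u, v} \<inter> {u', v'})"
    using assms(1) unfolding planar_embedding_def by (elim conjE)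
  from this[rule_format, OF assms(2-)] show ?thesis .
qed

text \<open>The arcs of successive edges are joined. The last clause, placing each point on an edge
  with both ends in \<open>W\<close>, controls intersections: within the induction, of the first
  edge with the rest, and later, of arcs coming from different paths.\<close>

lemma planar_embedding_gpath_arc:
  assumes emb: "planar_embedding V E p \<gamma>"
    and "gpath E a b W" "W \<subseteq> V" "a \<noteq> b"
  shows "\<exists>g. arc g \<and> pathstart g = p a \<and> pathfinish g = p b \<and> p ` W \<subseteq> path_image g \<and>
    (\<forall>z\<in>path_image g. \<exists>u\<in>W. \<exists>v\<in>W. E u v \<and> z \<in> path_image (\<gamma> u v))"
  using assms(2-)
proof (induction rule: gpath.induct)
  case (refl a)
  then show ?case by simp
next
  case (step a b c W)
  have V: "a \<in> V" "b \<in> V" "b \<in> W"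
    using step gpath_ends by fastforce+
  have ab: "arc (\<gamma> a b)" "pathstart (\<gamma> a b) = p a" "pathfinish (\<gamma> a b) = p b"
    using emb V step.hyps(1) unfolding planar_embedding_def by blast+
  show ?case
  proof (cases "b = c")
    case True
    then have "W = {c}" using step gpath_refl_iff by metis
    moreover have "p a \<in> path_image (\<gamma> a b)" "p b \<in> path_image (\<gamma> a b)"
      by (metis ab pathstart_in_path_image pathfinish_in_path_image)+
    ultimately show ?thesis
      using ab step.hyps(1) True by (intro exI[of _ "\<gamma> a b"]) auto
  next
    case False
    then obtain g where g: "arc g" "pathstart g = p b" "pathfinish g = p c" "p ` W \<subseteq> path_image g"
      "\<And>z. z \<in> path_image g \<Longrightarrow> \<exists>u\<in>W. \<exists>v\<in>W. E u v \<and> z \<in> path_image (\<gamma> u v)"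
      using step by auto
    \<comment> \<open>Since \<open>a\<close> is not in \<open>W\<close>, the first edge differs from
      every edge inside \<open>W\<close> and can share only the vertex \<open>b\<close> with
      it.\<close>
    have "path_image (\<gamma> a b) \<inter> path_image g \<subseteq> {p b}"
    proof
      fix z assume z: "z \<in> path_image (\<gamma> a b) \<inter> path_image g"
      then obtain u v where uv: "u \<in> W" "v \<in> W" "E u v" "z \<in> path_image (\<gamma> u v)"
        using g(5) by blast
      then have "{a, b} \<noteq> {u, v}" using step.hyps(3) by (auto simp: doubleton_eq_iff)
      then have "path_image (\<gamma> a b) \<inter> path_image (\<gamma> u v) \<subseteq> p ` ({a, b} \<inter> {u, v})"
        using planar_embedding_edges_Int[OF emb V(1,2) _ _ step.hyps(1) uv(3)] uv(1,2) step.prems(1)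
        by blast
      then show "z \<in> {p b}" using z uv step.hyps(3) by blast
    qed
    then have "arc (\<gamma> a b +++ g)"
      using ab g by (intro arc_join) auto
    moreover have "path_image (\<gamma> a b +++ g) = path_image (\<gamma> a b) \<union> path_image g"
      using ab g by (simp add: path_image_join)
    moreover have "p a \<in> path_image (\<gamma> a b)"
      by (metis ab(2) pathstart_in_path_image)
    ultimately show ?thesis
      using ab g step.hyps(1) V(3)
      by (intro exI[of _ "\<gamma> a b +++ g"]) (auto, blast+)
  qed
qed

text \<open>The paths are drawn as three arcs meeting only in \<open>p a\<close> and
  \<open>p b\<close>. Each contains the image of an inner vertex, which lies on the frontier of the
  unbounded face, so \<open>theta_not_outer\<close> applies.\<close>

lemma outer_planar_graph_no_theta:
  assumes op: "outer_planar_graph V E"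
    and ab: "a \<noteq> b" "\<not> E a b" "\<not> E b a"
    and paths: "gpath E a b W1" "gpath E a b W2" "gpath E a b W3"
    and V: "W1 \<subseteq> V" "W2 \<subseteq> V" "W3 \<subseteq> V"
    and disj: "W1 \<inter> W2 \<subseteq> {a, b}" "W1 \<inter> W3 \<subseteq> {a, b}" "W2 \<inter> W3 \<subseteq> {a, b}"
  shows False
proof -
  obtain p \<gamma> F where emb: "planar_embedding V E p \<gamma>"
    and F: "F \<in> components (UNIV - graph_drawing V E p \<gamma>)" "\<not> bounded F" "p ` V \<subseteq> frontier F"
    using op unfolding outer_planar_graph_def by blast
  have "inj_on p V" using emb unfolding planar_embedding_def by blast
  have arcs: "\<exists>g x. arc g \<and> pathstart g = p a \<and> pathfinish g = p b \<and>
      x \<in> path_image g - {p a, p b} \<and> x \<in> closure F \<and> F \<inter> path_image g = {} \<and>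
      (\<forall>z\<in>path_image g. \<exists>u\<in>W. \<exists>v\<in>W. E u v \<and> z \<in> path_image (\<gamma> u v))"
    if W: "gpath E a b W" "W \<subseteq> V" for W
  proof -
    obtain g where g: "arc g" "pathstart g = p a" "pathfinish g = p b" "p ` W \<subseteq> path_image g"
      "\<forall>z\<in>path_image g. \<exists>u\<in>W. \<exists>v\<in>W. E u v \<and> z \<in> path_image (\<gamma> u v)"
      using planar_embedding_gpath_arc[OF emb W ab(1)] by blast
    obtain c where c: "c \<in> W" "c \<noteq> a" "c \<noteq> b"
      using gpath_inner_vertex[OF W(1) ab(1,2)] .
    have "a \<in> V" "b \<in> V" "c \<in> V" using W c gpath_ends[OF W(1)] by auto
    then have "p c \<noteq> p a" "p c \<noteq> p b" using \<open>inj_on p V\<close> c by (auto dest: inj_onD)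
    moreover have "p c \<in> closure F"
      using F(3) \<open>c \<in> V\<close> unfolding frontier_def by blast
    moreover have "path_image g \<subseteq> graph_drawing V E p \<gamma>"
    proof
      fix z assume "z \<in> path_image g"
      then obtain u v where "u \<in> V" "v \<in> V" "E u v" "z \<in> path_image (\<gamma> u v)"
        using g(5) W(2) by blast
      then show "z \<in> graph_drawing V E p \<gamma>"
        unfolding graph_drawing_def by (intro UnI2 UnionI[of "path_image (\<gamma> u v)"]) auto
    qed
    then have "F \<inter> path_image g = {}"
      using in_components_subset[OF F(1)] by blast
    ultimately show ?thesis
      using g c by (intro exI[of _ g] exI[of _ "p c"]) auto
  qed
  have meet: "path_image g \<inter> path_image h = {p a, p b}"
    if "arc g" "pathstart g = p a" "pathfinish g = p b" "pathstart h = p a" "pathfinish h = p b"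
      and g: "\<forall>z\<in>path_image g. \<exists>u\<in>W. \<exists>v\<in>W. E u v \<and> z \<in> path_image (\<gamma> u v)"
      and h: "\<forall>z\<in>path_image h. \<exists>u\<in>X. \<exists>v\<in>X. E u v \<and> z \<in> path_image (\<gamma> u v)"
      and WX: "W \<subseteq> V" "X \<subseteq> V" "W \<inter> X \<subseteq> {a, b}" for g h W X
  proof
    show "{p a, p b} \<subseteq> path_image g \<inter> path_image h"
      using that(2-5) pathstart_in_path_image[of g] pathfinish_in_path_image[of g]
        pathstart_in_path_image[of h] pathfinish_in_path_image[of h] by simp
    show "path_image g \<inter> path_image h \<subseteq> {p a, p b}"
    proof
      fix z assume z: "z \<in> path_image g \<inter> path_image h"
      obtain u v where uv: "u \<in> W" "v \<in> W" "E u v" "z \<in> path_image (\<gamma> u v)"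
        using g z by blast
      obtain u' v' where uv': "u' \<in> X" "v' \<in> X" "E u' v'" "z \<in> path_image (\<gamma> u' v')"
        using h z by blast
      \<comment> \<open>A loop would be drawn as an arc with equal ends, which does not
        exist.\<close>
      have "\<not> E w w" if "w \<in> V" for w
        using emb that arc_distinct_ends unfolding planar_embedding_def by metis
      then have "u \<noteq> v" using uv WX by blast
      \<comment> \<open>A common edge would have both ends in \<open>W \<inter> X\<close>, so it
        would join \<open>a\<close> and \<open>b\<close>, which are not adjacent.\<close>
      have "{u, v} \<noteq> {u', v'}"
      proof
        assume "{u, v} = {u', v'}"
        then have "u \<in> X" "v \<in> X" using uv' by (auto simp: doubleton_eq_iff)
        then have "u \<in> {a, b}" "v \<in> {a, b}" using uv WX by blast+
        then show False using \<open>u \<noteq> v\<close> uv ab by blast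
      qed
      moreover have "u \<in> V" "v \<in> V" "u' \<in> V" "v' \<in> V"
        using uv(1,2) uv'(1,2) WX(1,2) by blast+
      ultimately have "path_image (\<gamma> u v) \<inter> path_image (\<gamma> u' v') \<subseteq> p ` ({u, v} \<inter> {u', v'})"
        using planar_embedding_edges_Int[OF emb _ _ _ _ uv(3) uv'(3)] by meson
      moreover have "{u, v} \<inter> {u', v'} \<subseteq> {a, b}"
        using uv(1,2) uv'(1,2) WX(3) by blast
      ultimately show "z \<in> {p a, p b}" using uv(4) uv'(4) by blast
    qed
  qed
  obtain g1 x1 where g1: "arc g1" "pathstart g1 = p a" "pathfinish g1 = p b"
      "x1 \<in> path_image g1 - {p a, p b}" "x1 \<in> closure F" "F \<inter> path_image g1 = {}"
      "\<forall>z\<in>path_image g1. \<exists>u\<in>W1. \<exists>v\<in>W1. E u v \<and> z \<in> path_image (\<gamma> u v)"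
    using arcs[OF paths(1) V(1)] by blast
  obtain g2 x2 where g2: "arc g2" "pathstart g2 = p a" "pathfinish g2 = p b"
      "x2 \<in> path_image g2 - {p a, p b}" "x2 \<in> closure F" "F \<inter> path_image g2 = {}"
      "\<forall>z\<in>path_image g2. \<exists>u\<in>W2. \<exists>v\<in>W2. E u v \<and> z \<in> path_image (\<gamma> u v)"
    using arcs[OF paths(2) V(2)] by blast
  obtain g3 x3 where g3: "arc g3" "pathstart g3 = p a" "pathfinish g3 = p b"
      "x3 \<in> path_image g3 - {p a, p b}" "x3 \<in> closure F" "F \<inter> path_image g3 = {}"
      "\<forall>z\<in>path_image g3. \<exists>u\<in>W3. \<exists>v\<in>W3. E u v \<and> z \<in> path_image (\<gamma> u v)"
    using arcs[OF paths(3) V(3)] by blast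
  have "path_image g1 \<inter> path_image g2 = {p a, p b}"
    by (rule meet[OF g1(1,2,3) g2(2,3) g1(7) g2(7) V(1,2) disj(1)])
  moreover have "path_image g1 \<inter> path_image g3 = {p a, p b}"
    by (rule meet[OF g1(1,2,3) g3(2,3) g1(7) g3(7) V(1,3) disj(2)])
  moreover have "path_image g2 \<inter> path_image g3 = {p a, p b}"
    by (rule meet[OF g2(1,2,3) g3(2,3) g2(7) g3(7) V(2,3) disj(3)])
  moreover have "F \<inter> (path_image g1 \<union> path_image g2 \<union> path_image g3) = {}"
    using g1 g2 g3 by blast
  ultimately show False
    using theta_not_outer[OF g1(1) g2(1) g3(1) g1(2,3) g2(2,3) g3(2,3) _ _ _
      in_components_connected[OF F(1)] F(2) _ g1(4,5) g2(4,5) g3(4,5)] by simp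
qed

subsection \<open>Maximal subgroups\<close>

lemma subgroup_dcc_imp_wf:
  assumes "subgroup_dcc G"
  shows "wf {(H, K). subgroup H G \<and> subgroup K G \<and> H \<subset> K}"
  unfolding wf_iff_no_infinite_down_chain
proof
  assume "\<exists>f. \<forall>i. (f (Suc i), f i) \<in> {(H, K). subgroup H G \<and> subgroup K G \<and> H \<subset> K}"
  then obtain f where "\<forall>i. (f (Suc i), f i) \<in> {(H, K). subgroup H G \<and> subgroup K G \<and> H \<subset> K}" ..
  then have f: "\<forall>i. subgroup (f i) G" "\<forall>i. f (Suc i) \<subset> f i"
    by simp_all
  then have "\<forall>i. f (Suc i) \<subseteq> f i" by (simp add: psubset_eq)
  then obtain N where N: "\<forall>n\<ge>N. f n = f N"
    using assms f(1) unfolding subgroup_dcc_def by blast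
  have "f (Suc N) = f N"
    by (rule N[rule_format]) simp
  then show False
    using f(2)[rule_format, of N] by (simp only: psubset_eq simp_thms)
qed

lemma subgroup_acc_imp_wf:
  assumes "subgroup_acc G"
  shows "wf {(H, K). subgroup H G \<and> subgroup K G \<and> K \<subset> H}"
  unfolding wf_iff_no_infinite_down_chain
proof
  assume "\<exists>f. \<forall>i. (f (Suc i), f i) \<in> {(H, K). subgroup H G \<and> subgroup K G \<and> K \<subset> H}"
  then obtain f where "\<forall>i. (f (Suc i), f i) \<in> {(H, K). subgroup H G \<and> subgroup K G \<and> K \<subset> H}" ..
  then have f: "\<forall>i. subgroup (f i) G" "\<forall>i. f i \<subset> f (Suc i)"
    by simp_all
  then have "\<forall>i. f i \<subseteq> f (Suc i)" by (simp add: psubset_eq)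
  then obtain N where N: "\<forall>n\<ge>N. f n = f N"
    using assms f(1) unfolding subgroup_acc_def by blast
  have "f (Suc N) = f N"
    by (rule N[rule_format]) simp
  then show False
    using f(2)[rule_format, of N] by (simp only: psubset_eq simp_thms)
qed

text \<open>The ascending chain condition makes reverse inclusion well-founded, so the proper
  subgroups of \<open>K\<close> above \<open>H\<close> have a member that is largest
  possible.\<close>

lemma subgroup_acc_imp_maximal_subgroup:
  assumes "subgroup_acc G" "subgroup H G" "subgroup K G" "H \<subset> K"
  obtains M where "maximal_subgroup M K G" "H \<subseteq> M"
proof -
  let ?S = "{L. subgroup L G \<and> H \<subseteq> L \<and> L \<subset> K}"
  have "H \<in> ?S" using assms by blast
  then obtain M where M: "M \<in> ?S"
    "\<And>L. (L, M) \<in> {(H, K). subgroup H G \<and> subgroup K G \<and> K \<subset> H} \<Longrightarrow> L \<notin> ?S"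
    by (rule wfE_min[OF subgroup_acc_imp_wf[OF assms(1)]]) (rule that)
  have "maximal_subgroup M K G"
    unfolding maximal_subgroup_def
  proof (intro conjI allI impI)
    fix L assume L: "subgroup L G" "M \<subseteq> L" "L \<subseteq> K"
    show "L = M \<or> L = K"
    proof (rule ccontr)
      assume "\<not> (L = M \<or> L = K)"
      then have "L \<in> ?S" "M \<subset> L" using L M(1) by blast+
      then show False using M(1) M(2)[of L] L(1) by simp
    qed
  qed (use M(1) assms in auto)
  then show thesis using that M(1) by blast
qed

section \<open>Chains of maximal inclusions as paths in the subgroup graph\<close>

lemma symp_subgroup_graph_adj: "symp (subgroup_graph_adj G)"
  unfolding symp_def subgroup_graph_adj_def by blast

lemma maximal_subgroup_subset: "maximal_subgroup M K G \<Longrightarrow> M \<subset> K"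
  by (simp add: maximal_subgroup_def)

lemma maximal_subgroup_subgroup:
  "maximal_subgroup M K G \<Longrightarrow> subgroup M G" "maximal_subgroup M K G \<Longrightarrow> subgroup K G"
  by (simp_all add: maximal_subgroup_def)

lemma gpath_extend_maximal_subgroup:
  assumes "maximal_subgroup M K G" "gpath (subgroup_graph_adj G) M H W" "W \<subseteq> {L. L \<subseteq> M}"
  shows "gpath (subgroup_graph_adj G) K H (insert K W)"
proof (rule gpath.step[OF _ assms(2)])
  show "K \<notin> W"
    using assms(3) maximal_subgroup_subset[OF assms(1)] by blast
qed (use assms(1) in \<open>simp add: subgroup_graph_adj_def\<close>)

text \<open>One descends from \<open>K\<close> to a maximal subgroup still containing
  \<open>H\<close> and repeats. The ascending condition supplies each step and the descending
  condition ends the descent. Keeping all vertices between \<open>H\<close> and \<open>K\<close> is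
  what later bounds intersections of paths.\<close>

lemma gpath_subgroup_interval:
  assumes acc: "subgroup_acc G" and dcc: "subgroup_dcc G"
    and "subgroup H G" "subgroup K G" "H \<subseteq> K"
  shows "\<exists>W. gpath (subgroup_graph_adj G) K H W \<and> W \<subseteq> {L. subgroup L G \<and> H \<subseteq> L \<and> L \<subseteq> K}"
  using assms(4,5)
proof (induction K rule: wf_induct_rule[OF subgroup_dcc_imp_wf[OF dcc]])
  case (1 K)
  show ?case
  proof (cases "H = K")
    case True
    then show ?thesis using 1 gpath.refl by (intro exI[of _ "{K}"]) (auto intro: gpath.refl)
  next
    case False
    then obtain M where M: "maximal_subgroup M K G" "H \<subseteq> M"
      using subgroup_acc_imp_maximal_subgroup[OF acc assms(3) 1(2)] 1(3) by blast
    then obtain W where W: "gpath (subgroup_graph_adj G) M H W"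
        "W \<subseteq> {L. subgroup L G \<and> H \<subseteq> L \<and> L \<subseteq> M}"
      using 1(1)[of M] 1(2) maximal_subgroup_subset[OF M(1)] maximal_subgroup_subgroup[OF M(1)]
      by auto
    then have "gpath (subgroup_graph_adj G) K H (insert K W)"
      using gpath_extend_maximal_subgroup[OF M(1)] by blast
    moreover have "insert K W \<subseteq> {L. subgroup L G \<and> H \<subseteq> L \<and> L \<subseteq> K}"
      using W(2) 1(2,3) maximal_subgroup_subset[OF M(1)] by blast
    ultimately show ?thesis by blast
  qed
qed

text \<open>After \<open>K\<close> the path stays below \<open>M\<close>. Hence paths through two
  maximal subgroups share, apart from \<open>K\<close>, only subgroups of their
  intersection.\<close>

lemma gpath_via_maximal_subgroup:
  assumes "subgroup_acc G" "subgroup_dcc G" "maximal_subgroup M K G" "subgroup H G" "H \<subseteq> M"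
  obtains W where "gpath (subgroup_graph_adj G) K H (insert K W)"
    "W \<subseteq> {L. subgroup L G \<and> H \<subseteq> L \<and> L \<subseteq> M}"
proof -
  obtain W where W: "gpath (subgroup_graph_adj G) M H W" "W \<subseteq> {L. subgroup L G \<and> H \<subseteq> L \<and> L \<subseteq> M}"
    using gpath_subgroup_interval[OF assms(1,2,4) maximal_subgroup_subgroup(1)[OF assms(3)] assms(5)]
    by blast
  then show thesis
    using that gpath_extend_maximal_subgroup[OF assms(3) W(1)] by blast
qed

section \<open>Thetas below three maximal subgroups\<close>

lemma maximal_subgroup_not_subset:
  assumes "maximal_subgroup A K G" "maximal_subgroup B K G" "A \<noteq> B"
  shows "\<not> A \<subseteq> B"
proof
  assume "A \<subseteq> B"
  then have "B = A \<or> B = K"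
    using assms(1,2) unfolding maximal_subgroup_def by blast
  then show False
    using assms maximal_subgroup_subset by blast
qed

lemma not_adj_of_between:
  assumes "subgroup A G" "H \<subset> A" "A \<subset> K"
  shows "\<not> subgroup_graph_adj G K H" "\<not> subgroup_graph_adj G H K"
proof -
  have "\<not> maximal_subgroup K H G"
    using assms maximal_subgroup_subset by blast
  moreover have "\<not> maximal_subgroup H K G"
    using assms unfolding maximal_subgroup_def by blast
  ultimately show "\<not> subgroup_graph_adj G K H" "\<not> subgroup_graph_adj G H K"
    unfolding subgroup_graph_adj_def by simp_all
qed

text \<open>The subgroup \<open>A\<close> strictly between \<open>H\<close> and \<open>K\<close>
  makes these ends distinct and non-adjacent.\<close>

lemma outer_planar_group_no_theta:
  assumes "outer_planar_group G" "subgroup A G" "H \<subset> A" "A \<subset> K"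
    and paths: "gpath (subgroup_graph_adj G) K H W1" "gpath (subgroup_graph_adj G) K H W2"
      "gpath (subgroup_graph_adj G) K H W3"
    and V: "W1 \<subseteq> {L. subgroup L G}" "W2 \<subseteq> {L. subgroup L G}" "W3 \<subseteq> {L. subgroup L G}"
    and disj: "W1 \<inter> W2 \<subseteq> {K, H}" "W1 \<inter> W3 \<subseteq> {K, H}" "W2 \<inter> W3 \<subseteq> {K, H}"
  shows False
proof -
  have "K \<noteq> H" using assms(3,4) by blast
  from outer_planar_graph_no_theta[OF assms(1)[unfolded outer_planar_group_def] this
        not_adj_of_between[OF assms(2-4)] paths V disj] show False .
qed

text \<open>Otherwise \<open>K\<close> and \<open>A \<inter> C\<close> are the ends of a theta: two
  paths descend through \<open>A\<close> and through \<open>C\<close>, and the third descends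
  through \<open>B\<close> to the triple intersection and climbs back. Vertices of the third path
  other than \<open>K\<close> lie below \<open>B\<close> or below \<open>A \<inter> C\<close>, while
  those of the first two contain \<open>A \<inter> C\<close>, which is not below
  \<open>B\<close>.\<close>

lemma maximal_subgroups_Int_subset:
  assumes group: "group G" and op: "outer_planar_group G"
    and acc: "subgroup_acc G" and dcc: "subgroup_dcc G"
    and max: "maximal_subgroup A K G" "maximal_subgroup B K G" "maximal_subgroup C K G"
    and neq: "A \<noteq> C"
  shows "A \<inter> C \<subseteq> B"
proof (rule ccontr)
  assume nsub: "\<not> A \<inter> C \<subseteq> B"
  let ?E = "A \<inter> C" and ?D = "A \<inter> C \<inter> B" and ?adj = "subgroup_graph_adj G"
  note max_sub = maximal_subgroup_subset[OF max(1)] maximal_subgroup_subset[OF max(2)]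
    maximal_subgroup_subset[OF max(3)]
  have sub: "subgroup A G" "subgroup B G" "subgroup C G" "subgroup K G" "subgroup ?E G" "subgroup ?D G"
    using max maximal_subgroup_subgroup group.subgroups_Inter_pair[OF group] by metis+
  obtain WA where WA: "gpath ?adj K ?E (insert K WA)" "WA \<subseteq> {L. subgroup L G \<and> ?E \<subseteq> L \<and> L \<subseteq> A}"
    using gpath_via_maximal_subgroup[OF acc dcc max(1) sub(5)] by blast
  obtain WC where WC: "gpath ?adj K ?E (insert K WC)" "WC \<subseteq> {L. subgroup L G \<and> ?E \<subseteq> L \<and> L \<subseteq> C}"
    using gpath_via_maximal_subgroup[OF acc dcc max(3) sub(5)] by blast
  obtain WB where WB: "gpath ?adj K ?D (insert K WB)" "WB \<subseteq> {L. subgroup L G \<and> ?D \<subseteq> L \<and> L \<subseteq> B}"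
    using gpath_via_maximal_subgroup[OF acc dcc max(2) sub(6)] by blast
  obtain WD where WD: "gpath ?adj ?E ?D WD" "WD \<subseteq> {L. subgroup L G \<and> ?D \<subseteq> L \<and> L \<subseteq> ?E}"
    using gpath_subgroup_interval[OF acc dcc sub(6,5)] by blast
  \<comment> \<open>A subgroup on both the descent and the climb is below \<open>B\<close> and below
    \<open>?E\<close>, so it is \<open>?D\<close>; \<open>K\<close> itself is not below
    \<open>?E\<close>.\<close>
  have "insert K WB \<inter> WD \<subseteq> {?D}"
    using WB(2) WD(2) max_sub by auto
  from gpath_trans[OF WB(1) gpath_rev[OF symp_subgroup_graph_adj WD(1)] this]
  have WBD: "gpath ?adj K ?E (insert K WB \<union> WD)" .
  have EA: "?E \<subset> A"
    using maximal_subgroup_not_subset[OF max(1,3) neq] by blast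
  have V: "insert K WA \<subseteq> {L. subgroup L G}" "insert K WC \<subseteq> {L. subgroup L G}"
    "insert K WB \<union> WD \<subseteq> {L. subgroup L G}"
    using WA(2) WC(2) WB(2) WD(2) sub(4) by auto
  have disj: "insert K WA \<inter> insert K WC \<subseteq> {K, ?E}"
    "insert K WA \<inter> (insert K WB \<union> WD) \<subseteq> {K, ?E}"
    "insert K WC \<inter> (insert K WB \<union> WD) \<subseteq> {K, ?E}"
  proof -
    have "L = K \<or> L = ?E" if "L \<in> insert K WA" "L \<in> insert K WC" for L
      using that WA(2) WC(2) by auto
    then show "insert K WA \<inter> insert K WC \<subseteq> {K, ?E}" by auto
    have WBD': "L = K \<or> L \<subseteq> B \<or> L \<subseteq> ?E" if "L \<in> insert K WB \<union> WD" for L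
      using that WB(2) WD(2) by auto
    have "L = K \<or> L = ?E" if "L \<in> insert K WA" "L \<in> insert K WB \<union> WD" for L
      using WBD'[OF that(2)] that(1) WA(2) nsub by auto
    then show "insert K WA \<inter> (insert K WB \<union> WD) \<subseteq> {K, ?E}" by auto
    have "L = K \<or> L = ?E" if "L \<in> insert K WC" "L \<in> insert K WB \<union> WD" for L
      using WBD'[OF that(2)] that(1) WC(2) nsub by auto
    then show "insert K WC \<inter> (insert K WB \<union> WD) \<subseteq> {K, ?E}" by auto
  qed
  show False
    by (rule outer_planar_group_no_theta[OF op sub(1) EA max_sub(1) WA(1) WC(1) WBD V disj])
qed

text \<open>The inclusions just proved make all pairwise intersections of \<open>A\<close>,
  \<open>B\<close>, \<open>C\<close> equal. Descents from \<open>K\<close> to this common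
  intersection through the three subgroups then meet only at their ends.\<close>

lemma at_most_two_maximal_subgroups:
  assumes group: "group G" and op: "outer_planar_group G"
    and acc: "subgroup_acc G" and dcc: "subgroup_dcc G"
    and max: "maximal_subgroup A K G" "maximal_subgroup B K G" "maximal_subgroup C K G"
    and neq: "A \<noteq> B" "A \<noteq> C" "B \<noteq> C"
  shows False
proof -
  let ?D = "A \<inter> B" and ?adj = "subgroup_graph_adj G"
  have incl: "A \<inter> B \<subseteq> C" "A \<inter> C \<subseteq> B" "B \<inter> C \<subseteq> A"
    using maximal_subgroups_Int_subset[OF group op acc dcc] max neq by metis+
  have sub: "subgroup A G" "subgroup B G" "subgroup C G" "subgroup K G" "subgroup ?D G"
    using max maximal_subgroup_subgroup group.subgroups_Inter_pair[OF group] by metis+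
  obtain WA where WA: "gpath ?adj K ?D (insert K WA)" "WA \<subseteq> {L. subgroup L G \<and> ?D \<subseteq> L \<and> L \<subseteq> A}"
    using gpath_via_maximal_subgroup[OF acc dcc max(1) sub(5)] by blast
  obtain WB where WB: "gpath ?adj K ?D (insert K WB)" "WB \<subseteq> {L. subgroup L G \<and> ?D \<subseteq> L \<and> L \<subseteq> B}"
    using gpath_via_maximal_subgroup[OF acc dcc max(2) sub(5)] by blast
  obtain WC where WC: "gpath ?adj K ?D (insert K WC)" "WC \<subseteq> {L. subgroup L G \<and> ?D \<subseteq> L \<and> L \<subseteq> C}"
    using gpath_via_maximal_subgroup[OF acc dcc max(3) sub(5)] incl by blast
  have DA: "?D \<subset> A"
    using maximal_subgroup_not_subset[OF max(1,2) neq(1)] by blast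
  have V: "insert K WA \<subseteq> {L. subgroup L G}" "insert K WB \<subseteq> {L. subgroup L G}"
    "insert K WC \<subseteq> {L. subgroup L G}"
    using WA(2) WC(2) WB(2) sub(4) by auto
  have disj: "insert K WA \<inter> insert K WB \<subseteq> {K, ?D}" "insert K WA \<inter> insert K WC \<subseteq> {K, ?D}"
     "insert K WB \<inter> insert K WC \<subseteq> {K, ?D}"
  proof -
    have eq_D: "L = ?D" if "?D \<subseteq> L" "L \<subseteq> C" "L \<subseteq> A \<or> L \<subseteq> B" for L
      using that incl by blast
    have "L = K \<or> L = ?D" if "L \<in> insert K WA" "L \<in> insert K WB" for L
      using that WA(2) WB(2) by auto
    then show "insert K WA \<inter> insert K WB \<subseteq> {K, ?D}" by auto
    have "L = K \<or> L = ?D" if "L \<in> insert K WA" "L \<in> insert K WC" for L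
      using eq_D[of L] that WA(2) WC(2) by blast
    then show "insert K WA \<inter> insert K WC \<subseteq> {K, ?D}" by auto
    have "L = K \<or> L = ?D" if "L \<in> insert K WB" "L \<in> insert K WC" for L
      using eq_D[of L] that WB(2) WC(2) by blast
    then show "insert K WB \<inter> insert K WC \<subseteq> {K, ?D}" by auto
  qed
  show False
    by (rule outer_planar_group_no_theta[OF op sub(1) DA maximal_subgroup_subset[OF max(1)]
          WA(1) WB(1) WC(1) V disj])
qed

section \<open>Cyclicity\<close>

text \<open>Take \<open>a\<close> outside \<open>A\<close> and \<open>b\<close> outside
  \<open>B\<close>. If neither avoids both subgroups, then \<open>a\<close> is in \<open>B\<close>
  and \<open>b\<close> in \<open>A\<close>, and their product avoids both, since \<open>a\<close> or
  \<open>b\<close> could be recovered from it.\<close>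

lemma (in group) two_subgroups_not_cover:
  assumes A: "subgroup A G" "A \<noteq> carrier G" and B: "subgroup B G" "B \<noteq> carrier G"
  obtains x where "x \<in> carrier G" "x \<notin> A" "x \<notin> B"
proof -
  obtain a b where a: "a \<in> carrier G" "a \<notin> A" and b: "b \<in> carrier G" "b \<notin> B"
    using assms subgroup.subset[OF A(1)] subgroup.subset[OF B(1)] by blast
  show thesis
  proof (cases "a \<in> B \<and> b \<in> A")
    case True
    have "a = (a \<otimes> b) \<otimes> inv b" "b = inv a \<otimes> (a \<otimes> b)"
      using a(1) b(1) by (simp_all add: m_assoc inv_solve_left)
    moreover have "inv b \<in> A" "inv a \<in> B"
      using True subgroup.m_inv_closed A(1) B(1) by auto
    ultimately have "a \<otimes> b \<notin> A" "a \<otimes> b \<notin> B"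
      using a(2) b(2) subgroup.m_closed[OF A(1)] subgroup.m_closed[OF B(1)] by metis+
    then show thesis using that a b by blast
  qed (use that a b in blast)
qed

text \<open>Two proper subgroups do not cover the group, so some \<open>g\<close> avoids all maximal
  subgroups. If the powers of \<open>g\<close> formed a proper subgroup, it would lie in a maximal
  one by the ascending chain condition.\<close>

lemma (in group) cyclic_if_at_most_two_maximal_subgroups:
  assumes acc: "subgroup_acc G"
    and two: "\<And>A B C. maximal_subgroup A (carrier G) G \<Longrightarrow> maximal_subgroup B (carrier G) G \<Longrightarrow>
      maximal_subgroup C (carrier G) G \<Longrightarrow> A = B \<or> A = C \<or> B = C"
  obtains g where "g \<in> carrier G" "carrier G = range (\<lambda>k::int. g [^] k)"
proof -
  let ?max = "\<lambda>M. maximal_subgroup M (carrier G) G"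
  have "\<exists>g\<in>carrier G. \<forall>M. ?max M \<longrightarrow> g \<notin> M"
  proof (cases "\<exists>A. ?max A")
    case True
    then obtain A where A: "?max A" by blast
    \<comment> \<open>\<open>B\<close> may equal \<open>A\<close>, which covers the case of a single
      maximal subgroup.\<close>
    obtain B where B: "?max B" "\<And>M. ?max M \<Longrightarrow> M = A \<or> M = B"
      using A two by metis
    have "A \<noteq> carrier G" "B \<noteq> carrier G"
      using maximal_subgroup_subset A B(1) by blast+
    then obtain g where "g \<in> carrier G" "g \<notin> A" "g \<notin> B"
      using two_subgroups_not_cover maximal_subgroup_subgroup(1) A B(1) by metis
    then show ?thesis using B(2) by blast
  qed blast
  then obtain g where g: "g \<in> carrier G" "\<And>M. ?max M \<Longrightarrow> g \<notin> M" by blast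
  let ?H = "range (\<lambda>k::int. g [^] k)"
  have H: "subgroup ?H G" by (rule subgroup_of_powers[OF g(1)])
  have "g [^] (1::int) \<in> ?H" by blast
  then have "g \<in> ?H" using g(1) by (simp only: int_pow_1)
  have "?H = carrier G"
  proof (rule ccontr)
    assume "?H \<noteq> carrier G"
    then have "?H \<subset> carrier G" using subgroup.subset[OF H] by blast
    then show False
      using subgroup_acc_imp_maximal_subgroup[OF acc H subgroup_self] g(2) \<open>g \<in> ?H\<close> by blast
  qed
  then show thesis using that[OF g(1)] by simp
qed

subsection \<open>Subgroups of cyclic groups\<close>

text \<open>This is the subgroup generated by \<open>g ^ d\<close>. Parametrizing by exponents turns
  inclusion into reversed divisibility among divisors of \<open>ord g\<close>.\<close>

definition power_subgroup :: "('a, 'b) monoid_scheme \<Rightarrow> 'a \<Rightarrow> nat \<Rightarrow> 'a set" where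
  "power_subgroup G g d = range (\<lambda>k::int. g [^]\<^bsub>G\<^esub> (int d * k))"

context group
begin

lemma subgroup_power_subgroup:
  assumes "g \<in> carrier G" shows "subgroup (power_subgroup G g d) G"
  using subgroup_of_powers[of "g [^] int d"] assms
  by (simp add: power_subgroup_def int_pow_pow)

text \<open>The exponent of a power of \<open>g\<close> is determined modulo \<open>ord g\<close>,
  so its divisibility by a divisor \<open>d\<close> of \<open>ord g\<close> does not depend on the
  representative.\<close>

lemma power_mem_power_subgroup_iff:
  assumes "g \<in> carrier G" "d dvd ord g"
  shows "g [^] (j::int) \<in> power_subgroup G g d \<longleftrightarrow> int d dvd j"
proof
  assume "g [^] j \<in> power_subgroup G g d"
  then obtain k where "g [^] j = g [^] (int d * k)"
    by (auto simp: power_subgroup_def)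
  then have "int (ord g) dvd int d * k - j"
    using int_pow_eq[OF assms(1)] by blast
  then have "int d dvd int d * k - j"
    using assms(2) by (meson dvd_trans int_dvd_int_iff)
  then show "int d dvd j"
    by (simp add: dvd_diff_right_iff)
next
  assume "int d dvd j"
  then show "g [^] j \<in> power_subgroup G g d"
    by (auto simp: power_subgroup_def dvd_def)
qed

lemma power_subgroup_subset_iff:
  assumes "g \<in> carrier G" "d dvd ord g"
  shows "power_subgroup G g e \<subseteq> power_subgroup G g d \<longleftrightarrow> d dvd e"
proof
  assume sub: "power_subgroup G g e \<subseteq> power_subgroup G g d"
  have "g [^] (int e * 1) \<in> power_subgroup G g e"
    unfolding power_subgroup_def by (rule rangeI)
  then have "g [^] (int e) \<in> power_subgroup G g d"
    using sub by auto
  then show "d dvd e"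
    using power_mem_power_subgroup_iff[OF assms] by simp
next
  assume "d dvd e"
  show "power_subgroup G g e \<subseteq> power_subgroup G g d"
  proof
    fix x assume "x \<in> power_subgroup G g e"
    then obtain k where "x = g [^] (int e * k)" by (auto simp: power_subgroup_def)
    then show "x \<in> power_subgroup G g d"
      using power_mem_power_subgroup_iff[OF assms] \<open>d dvd e\<close> by simp
  qed
qed

lemma power_subgroup_eq_iff:
  assumes "g \<in> carrier G" "d dvd ord g" "e dvd ord g"
  shows "power_subgroup G g d = power_subgroup G g e \<longleftrightarrow> d = e"
  using power_subgroup_subset_iff[OF assms(1,2), of e] power_subgroup_subset_iff[OF assms(1,3), of d]
    dvd_antisym by blast

text \<open>An intermediate \<open>L\<close> not inside the smaller subgroup contains
  \<open>g ^ (d * i)\<close> for some \<open>i\<close> prime to \<open>r\<close>. Bezout's identity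
  for \<open>i\<close> and \<open>r\<close> then puts every power of \<open>g ^ d\<close> into
  \<open>L\<close>.\<close>

lemma maximal_power_subgroup:
  assumes g: "g \<in> carrier G" and dvd: "d * r dvd ord g" and "d > 0" "prime r"
  shows "maximal_subgroup (power_subgroup G g (d * r)) (power_subgroup G g d) G"
  unfolding maximal_subgroup_def
proof (intro conjI allI impI)
  have d: "d dvd ord g" using dvd by (rule dvd_mult_left)
  show "subgroup (power_subgroup G g (d * r)) G" "subgroup (power_subgroup G g d) G"
    using g by (rule subgroup_power_subgroup)+
  show "power_subgroup G g (d * r) \<subset> power_subgroup G g d"
    using power_subgroup_subset_iff[OF g d, of "d * r"] power_subgroup_eq_iff[OF g dvd d]
      \<open>d > 0\<close> prime_gt_1_nat[OF \<open>prime r\<close>] by auto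
  fix L assume L: "subgroup L G" "power_subgroup G g (d * r) \<subseteq> L" "L \<subseteq> power_subgroup G g d"
  show "L = power_subgroup G g (d * r) \<or> L = power_subgroup G g d"
  proof (cases "L \<subseteq> power_subgroup G g (d * r)")
    case False
    then obtain z where z: "z \<in> L" "z \<notin> power_subgroup G g (d * r)" by blast
    then obtain i where "z = g [^] (int d * i)"
      using L(3) by (auto simp: power_subgroup_def)
    with z have i: "g [^] (int d * i) \<in> L" "g [^] (int d * i) \<notin> power_subgroup G g (d * r)"
      by simp_all
    then have "\<not> int r dvd i"
      using power_mem_power_subgroup_iff[OF g dvd] by simp
    then have "coprime (int r) i"
      using \<open>prime r\<close> by (intro prime_imp_coprime) auto
    then obtain x y where xy: "x * i + y * int r = 1"
      by (metis bezout_int coprime_imp_gcd_eq_1 gcd.commute)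
    have "power_subgroup G g d \<subseteq> L"
    proof
      fix z assume "z \<in> power_subgroup G g d"
      then obtain k where z: "z = g [^] (int d * k)" by (auto simp: power_subgroup_def)
      \<comment> \<open>The first summand is a multiple of the exponent of the chosen element of
        \<open>L\<close>, the second gives an element of the smaller subgroup.\<close>
      have "int d * k = (int d * i) * (x * k) + int (d * r) * (y * k)"
      proof -
        have "int d * k = int d * k * (x * i + y * int r)" using xy by simp
        then show ?thesis by (simp add: algebra_simps)
      qed
      then have "z = (g [^] (int d * i)) [^] (x * k) \<otimes> g [^] (int (d * r) * (y * k))"
        using g z by (simp only: int_pow_mult int_pow_pow)
      moreover have "(g [^] (int d * i)) [^] (x * k) \<in> L"
        using i(1) L(1) by (rule subgroup_int_pow_closed[rotated])
      moreover have "g [^] (int (d * r) * (y * k)) \<in> L"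
        using L(2) unfolding power_subgroup_def by blast
      ultimately show "z \<in> L"
        using subgroup.m_closed[OF L(1)] by simp
    qed
    then show ?thesis using L(3) by blast
  qed (use L(2) in blast)
qed

text \<open>Infinite order is encoded as \<open>ord g = 0\<close>, which every number divides. The
  subgroups generated by \<open>g ^ (2 ^ n)\<close> would then descend strictly forever.\<close>

lemma ord_pos_if_subgroup_dcc:
  assumes "subgroup_dcc G" "g \<in> carrier G"
  shows "ord g > 0"
proof (rule ccontr)
  assume "\<not> ord g > 0"
  then have dvd: "d dvd ord g" for d by simp
  let ?f = "\<lambda>n. power_subgroup G g (2 ^ n)"
  have "\<forall>n. subgroup (?f n) G" "\<forall>n. ?f (Suc n) \<subseteq> ?f n"
    using subgroup_power_subgroup assms(2) power_subgroup_subset_iff[OF assms(2) dvd] by auto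
  then have "\<exists>N. \<forall>n\<ge>N. ?f n = ?f N"
    using assms(1)[unfolded subgroup_dcc_def, rule_format, of ?f] by simp
  then obtain N where N: "\<forall>n\<ge>N. ?f n = ?f N" ..
  have "?f (Suc N) = ?f N" by (rule N[rule_format]) simp
  then show False
    using power_subgroup_eq_iff[OF assms(2) dvd dvd] by simp
qed

lemma cyclic_iso_integer_mod_group:
  assumes g: "g \<in> carrier G" and gen: "carrier G = range (\<lambda>k::int. g [^] k)" and "ord g > 0"
  shows "finite (carrier G)" "G \<cong> integer_mod_group (ord g)"
proof -
  let ?n = "ord g" and ?h = "\<lambda>k::int. g [^] k"
  let ?Z = "integer_mod_group ?n"
  have pow_mod: "g [^] (k mod int ?n) = g [^] k" for k :: int
    using int_pow_eq[OF g] by (simp add: dvd_minus_mod)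
  have car: "carrier ?Z = {0..<int ?n}"
    using \<open>ord g > 0\<close> by (simp add: carrier_integer_mod_group)
  \<comment> \<open>Addition in \<open>?Z\<close> reduces modulo \<open>ord g\<close>, which
    \<open>pow_mod\<close> shows to be invisible in powers of \<open>g\<close>.\<close>
  have "?h \<in> hom ?Z G"
    using g by (intro homI) (simp_all add: pow_mod int_pow_mult)
  moreover have "inj_on ?h (carrier ?Z)"
  proof (rule inj_onI)
    fix i j assume ij: "i \<in> carrier ?Z" "j \<in> carrier ?Z" "g [^] i = g [^] j"
    then have "int ?n dvd j - i" using int_pow_eq[OF g] by blast
    then have "j mod int ?n = i mod int ?n" by (simp add: mod_eq_dvd_iff)
    then show "i = j" using ij car by simp
  qed
  moreover have image: "?h ` carrier ?Z = carrier G"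
  proof -
    have "g [^] k \<in> ?h ` carrier ?Z" for k :: int
      using pow_mod[of k] \<open>ord g > 0\<close> unfolding car by (intro image_eqI[of _ _ "k mod int ?n"]) auto
    then show ?thesis using gen by auto
  qed
  ultimately have "?h \<in> iso ?Z G"
    by (simp add: iso_def bij_betw_def)
  then show "G \<cong> ?Z"
    using group.iso_sym[OF group_integer_mod_group] unfolding is_iso_def by blast
  show "finite (carrier G)"
    using image car by (metis finite_atLeastLessThan_int finite_imageI)
qed

end

section \<open>Primes dividing the order of a generator\<close>

lemma prime_power_products_eq_iff:
  fixes p q :: nat
  assumes "prime p" "prime q" "p \<noteq> q"
  shows "p ^ i * q ^ j = p ^ i' * q ^ j' \<longleftrightarrow> i = i' \<and> j = j'"
proof
  assume eq: "p ^ i * q ^ j = p ^ i' * q ^ j'"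
  have "multiplicity p (p ^ a * q ^ b) = a" "multiplicity q (p ^ a * q ^ b) = b" for a b
    using assms by (simp_all add: prime_elem_multiplicity_mult_distrib multiplicity_distinct_prime_power)
  then show "i = i' \<and> j = j'" using eq by metis
qed auto

text \<open>The subgroups of index \<open>p\<^sup>i q\<^sup>j\<close> with \<open>i, j \<le> 2\<close> form a three by three grid. Its two middle
  points of opposite sides are joined through the centre and along both halves of the boundary.\<close>

lemma (in group) no_squares_of_two_primes_dvd_ord:
  assumes op: "outer_planar_group G" and g: "g \<in> carrier G" "ord g > 0"
    and pq: "prime p" "prime q" "p \<noteq> q"
  shows "\<not> p\<^sup>2 * q\<^sup>2 dvd ord g"
proof
  assume dvd: "p\<^sup>2 * q\<^sup>2 dvd ord g"
  \<comment> \<open>\<open>Q 0 0\<close> is generated by \<open>g\<close>; raising one exponent by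
    one passes to a maximal subgroup.\<close>
  define Q where "Q i j = power_subgroup G g (p ^ i * q ^ j)" for i j
  let ?adj = "subgroup_graph_adj G"
  have Q_dvd: "p ^ i * q ^ j dvd ord g" if "i \<le> 2" "j \<le> 2" for i j
    using that dvd_trans[OF mult_dvd_mono[OF le_imp_power_dvd le_imp_power_dvd] dvd] by blast
  have sub: "subgroup (Q i j) G" for i j
    unfolding Q_def using g(1) by (rule subgroup_power_subgroup)
  have inj: "Q i j = Q i' j' \<longleftrightarrow> i = i' \<and> j = j'" if "i \<le> 2" "j \<le> 2" "i' \<le> 2" "j' \<le> 2" for i j i' j'
    unfolding Q_def
    using power_subgroup_eq_iff[OF g(1) Q_dvd[OF that(1,2)] Q_dvd[OF that(3,4)]]
      prime_power_products_eq_iff[OF pq] by simp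
  have pos: "p ^ i * q ^ j > 0" for i j
    using pq prime_gt_0_nat by simp
  have max_p: "maximal_subgroup (Q (Suc i) j) (Q i j) G" if "Suc i \<le> 2" "j \<le> 2" for i j
    using maximal_power_subgroup[OF g(1) _ pos[of i j] pq(1)] Q_dvd[OF that]
    by (simp add: Q_def mult_ac)
  have max_q: "maximal_subgroup (Q i (Suc j)) (Q i j) G" if "i \<le> 2" "Suc j \<le> 2" for i j
    using maximal_power_subgroup[OF g(1) _ pos[of i j] pq(2)] Q_dvd[OF that]
    by (simp add: Q_def mult_ac)
  have max: "maximal_subgroup (Q 1 0) (Q 0 0) G" "maximal_subgroup (Q 2 0) (Q 1 0) G"
    "maximal_subgroup (Q 1 1) (Q 0 1) G" "maximal_subgroup (Q 2 1) (Q 1 1) G"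
    "maximal_subgroup (Q 1 2) (Q 0 2) G" "maximal_subgroup (Q 2 2) (Q 1 2) G"
    "maximal_subgroup (Q 0 1) (Q 0 0) G" "maximal_subgroup (Q 0 2) (Q 0 1) G"
    "maximal_subgroup (Q 2 1) (Q 2 0) G" "maximal_subgroup (Q 2 2) (Q 2 1) G"
    using max_p[of 0 0] max_p[of 1 0] max_p[of 0 1] max_p[of 1 1] max_p[of 0 2] max_p[of 1 2]
      max_q[of 0 0] max_q[of 0 1] max_q[of 2 0] max_q[of 2 1] by (simp_all add: numeral_2_eq_2)
  then have adj: "?adj (Q 0 1) (Q 1 1)" "?adj (Q 1 1) (Q 2 1)"
    "?adj (Q 0 1) (Q 0 0)" "?adj (Q 0 0) (Q 1 0)" "?adj (Q 1 0) (Q 2 0)" "?adj (Q 2 0) (Q 2 1)"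
    "?adj (Q 0 1) (Q 0 2)" "?adj (Q 0 2) (Q 1 2)" "?adj (Q 1 2) (Q 2 2)" "?adj (Q 2 2) (Q 2 1)"
    unfolding subgroup_graph_adj_def by simp_all
  have centre: "gpath ?adj (Q 0 1) (Q 2 1) {Q 0 1, Q 1 1, Q 2 1}"
    by (rule gpath.step[where E = ?adj, OF adj(1)] gpath.step[where E = ?adj, OF adj(2)] gpath.refl)+ (simp_all add: inj)
  have upper: "gpath ?adj (Q 0 1) (Q 2 1) {Q 0 1, Q 0 0, Q 1 0, Q 2 0, Q 2 1}"
    by (rule gpath.step[where E = ?adj, OF adj(3)] gpath.step[where E = ?adj, OF adj(4)] gpath.step[where E = ?adj, OF adj(5)]
        gpath.step[where E = ?adj, OF adj(6)] gpath.refl)+ (simp_all add: inj)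
  have lower: "gpath ?adj (Q 0 1) (Q 2 1) {Q 0 1, Q 0 2, Q 1 2, Q 2 2, Q 2 1}"
    by (rule gpath.step[where E = ?adj, OF adj(7)] gpath.step[where E = ?adj, OF adj(8)] gpath.step[where E = ?adj, OF adj(9)]
        gpath.step[where E = ?adj, OF adj(10)] gpath.refl)+ (simp_all add: inj)
  \<comment> \<open>The centre \<open>Q 1 1\<close> is the subgroup strictly between the ends
    \<open>Q 2 1\<close> and \<open>Q 0 1\<close>.\<close>
  show False
    by (rule outer_planar_group_no_theta[OF op sub maximal_subgroup_subset[OF max(4)]
          maximal_subgroup_subset[OF max(3)] centre upper lower]) (auto simp: sub inj)
qed

text \<open>This is \<open>maximal_power_subgroup\<close> for \<open>d = 1\<close>, where the larger
  subgroup is the whole group; each prime divisor of the order thus yields a maximal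
  subgroup.\<close>

lemma (in group) maximal_power_subgroup_prime:
  assumes "g \<in> carrier G" "carrier G = range (\<lambda>k::int. g [^] k)" "prime p" "p dvd ord g"
  shows "maximal_subgroup (power_subgroup G g p) (carrier G) G"
  using maximal_power_subgroup[of g 1 p] assms by (simp add: power_subgroup_def)

text \<open>After the full powers of two primes are split off, the cofactor is \<open>1\<close>, as
  a third prime is excluded. The exponents are not both at least two, so one of them is
  \<open>1\<close>.\<close>

lemma prime_power_or_prime_power_times_prime:
  fixes n :: nat
  assumes "n > 0"
    and three: "\<And>p q r. prime p \<Longrightarrow> prime q \<Longrightarrow> prime r \<Longrightarrow> p dvd n \<Longrightarrow> q dvd n \<Longrightarrow> r dvd n \<Longrightarrow>
      p = q \<or> p = r \<or> q = r"
    and squares: "\<And>p q. prime p \<Longrightarrow> prime q \<Longrightarrow> p \<noteq> q \<Longrightarrow> \<not> p\<^sup>2 * q\<^sup>2 dvd n"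
  shows "\<exists>p q m. prime p \<and> prime q \<and> p \<noteq> q \<and> (n = p ^ m \<or> n = p ^ m * q)"
proof -
  \<comment> \<open>The conclusion asks for a second prime even when \<open>n\<close> is
    \<open>1\<close> or a prime power.\<close>
  have other: "\<exists>q::nat. prime q \<and> p \<noteq> q" for p
    by (metis bigger_prime less_irrefl)
  show ?thesis
  proof (cases "n = 1")
    case True
    have "prime (2::nat)" by simp
    then show ?thesis using True other[of 2] by (metis power_0)
  next
    case False
    then obtain p where p: "prime p" "p dvd n"
      using prime_factor_nat by blast
    then obtain a n' where n': "n = p ^ a * n'" "\<not> p dvd n'"
      using multiplicity_decompose'[of n p] \<open>n > 0\<close> by (metis not_prime_unit neq0_conv)
    show ?thesis
    proof (cases "n' = 1")
      case True
      then show ?thesis using p n' other[of p] by auto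
    next
      case False
      then obtain q where q: "prime q" "q dvd n'"
        using prime_factor_nat by blast
      have "n' > 0" using n' \<open>n > 0\<close> by (cases "n' = 0") auto
      then obtain b n'' where n'': "n' = q ^ b * n''" "\<not> q dvd n''"
        using multiplicity_decompose'[of n' q] q by (metis not_prime_unit neq0_conv)
      have "p \<noteq> q" using n'(2) q(2) by blast
      have n: "n = p ^ a * q ^ b * n''" using n' n'' by (simp add: mult.assoc)
      have "n'' = 1"
      proof (rule ccontr)
        assume "n'' \<noteq> 1"
        then obtain r where r: "prime r" "r dvd n''"
          using prime_factor_nat by blast
        have "r dvd n'" using r n'' by simp
        then have "q dvd n" "r dvd n" using n'(1) q(2) by simp_all
        have "r \<noteq> p" "r \<noteq> q" using n'(2) n''(2) r(2) \<open>r dvd n'\<close> by blast+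
        then show False
          using three[OF p(1) q(1) r(1) p(2)] \<open>p \<noteq> q\<close> \<open>q dvd n\<close> \<open>r dvd n\<close> by blast
      qed
      have a: "a > 0" using p n' by (cases a) auto
      have b: "b > 0" using q n'' by (cases b) auto
      have "\<not> (2 \<le> a \<and> 2 \<le> b)"
      proof
        assume "2 \<le> a \<and> 2 \<le> b"
        then have "p\<^sup>2 * q\<^sup>2 dvd n"
          using n by (simp add: mult_dvd_mono le_imp_power_dvd \<open>n'' = 1\<close>)
        then show False using squares[OF p(1) q(1) \<open>p \<noteq> q\<close>] by blast
      qed
      then consider "a = 1" | "b = 1" using a b by linarith
      then show ?thesis
      proof cases
        case 1
        \<comment> \<open>Here \<open>p\<close> is the simple factor, so \<open>p\<close> and
          \<open>q\<close> exchange roles in the conclusion.\<close>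
        then have "n = q ^ b * p" using n \<open>n'' = 1\<close> by simp
        then show ?thesis using p q \<open>p \<noteq> q\<close> by metis
      next
        case 2
        then have "n = p ^ a * q" using n \<open>n'' = 1\<close> by simp
        then show ?thesis using p q \<open>p \<noteq> q\<close> by metis
      qed
    qed
  qed
qed

theorem theorem3p15:
  fixes G :: "('a, 'b) monoid_scheme"
  assumes "group G"
    and "outer_planar_group G"
    and "subgroup_acc G"
    and "subgroup_dcc G"
  shows "finite (carrier G) \<and>
         (\<exists>p q m :: nat. prime p \<and> prime q \<and> p \<noteq> q \<and>
            (G \<cong> integer_mod_group (p ^ m) \<or> G \<cong> integer_mod_group (p ^ m * q)))"
proof -
  interpret group G by fact
  obtain g where g: "g \<in> carrier G" and gen: "carrier G = range (\<lambda>k::int. g [^]\<^bsub>G\<^esub> k)"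
    using cyclic_if_at_most_two_maximal_subgroups[OF assms(3)]
      at_most_two_maximal_subgroups[OF assms] by metis
  have pos: "ord g > 0" by (rule ord_pos_if_subgroup_dcc[OF assms(4) g])
  have "\<exists>p q m. prime p \<and> prime q \<and> p \<noteq> q \<and> (ord g = p ^ m \<or> ord g = p ^ m * q)"
  proof (rule prime_power_or_prime_power_times_prime[OF pos])
    fix p q r :: nat
    assume pqr: "prime p" "prime q" "prime r" "p dvd ord g" "q dvd ord g" "r dvd ord g"
    show "p = q \<or> p = r \<or> q = r"
      \<comment> \<open>Distinct primes dividing \<open>ord g\<close> give distinct maximal
        subgroups of the whole group, of which there are at most two.\<close>
      using at_most_two_maximal_subgroups[OF assms
          maximal_power_subgroup_prime[OF g gen pqr(1,4)] maximal_power_subgroup_prime[OF g gen pqr(2,5)]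
          maximal_power_subgroup_prime[OF g gen pqr(3,6)]]
        power_subgroup_eq_iff[OF g] pqr(4-6) by metis
  qed (rule no_squares_of_two_primes_dvd_ord[OF assms(2) g pos])
  then show ?thesis
    using cyclic_iso_integer_mod_group[OF g gen pos] by metis
qed

end
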